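(* Let $v=(a,b)$ be a cell of the $n\times n$ board (any board size $n$). (i) If $v$ is one cell away from a border, or is a border cell next to a corner (that is, $a\in\{2,n-1\}$ or $b\in\{2,n-1\}$), then an enemy king on $v$ cannot be trapped by kings. (ii) Otherwise an enemy king on $v$ can be trapped, and the minimum number of kings needed is: $2$ if $v$ is a corner cell; $3$ if $v$ is on the border but not a corner; and $4$ if $v$ is not on the border (so it is at least two cells away from every border).
   Context: Cells of the $n\times n$ board are $(x,y)$ with $1\le x,y\le n$; a cell is on the border if one of its coordinates is $1$ or $n$, and it is a corner if both are. A king attacks (can move to) every horizontally, vertically, or diagonally adjacent cell. A set $T$ of cells not containing $v$ (the positions of the soldier kings) traps an enemy king on $v$ if: (1) no two distinct cells of $T\cup\{v\}$ attack each other; and (2) every cell attacked from $v$ is attacked from some cell of $T$. The number of kings used is $|T|$.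
   Formalization: The value 2 at a corner cell is claimed only for board size n ≠ 1: on the 1×1 board the only cell is a corner that attacks nothing, so the empty set traps the king and the minimum is 0. *)

theory Defs imports Main begin

type_synonym cell = "int \<times> int"

definition board :: "nat \<Rightarrow> cell set" where
  "board n = {1..int n} \<times> {1..int n}"

definition border_cell :: "nat \<Rightarrow> cell \<Rightarrow> bool" where
  "border_cell n v \<longleftrightarrow> v \<in> board n \<and> (fst v \<in> {1, int n} \<or> snd v \<in> {1, int n})"

definition corner_cell :: "nat \<Rightarrow> cell \<Rightarrow> bool" where
  "corner_cell n v \<longleftrightarrow> v \<in> board n \<and> fst v \<in> {1, int n} \<and> snd v \<in> {1, int n}"

definition king_attacks :: "cell \<Rightarrow> cell \<Rightarrow> bool" where
  "king_attacks p q \<longleftrightarrow> p \<noteq> q \<and> \<bar>fst p - fst q\<bar> \<le> 1 \<and> \<bar>snd p - snd q\<bar> \<le> 1"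

definition kings_trap :: "nat \<Rightarrow> cell set \<Rightarrow> cell \<Rightarrow> bool" where
  "kings_trap n T v \<longleftrightarrow>
     T \<subseteq> board n \<and> v \<notin> T \<and>
     (\<forall>p \<in> T \<union> {v}. \<forall>q \<in> T \<union> {v}. p \<noteq> q \<longrightarrow> \<not> king_attacks p q) \<and>
     (\<forall>w \<in> board n. king_attacks v w \<longrightarrow> (\<exists>p \<in> T. king_attacks p w))"

definition can_be_trapped :: "nat \<Rightarrow> cell \<Rightarrow> bool" where
  "can_be_trapped n v \<longleftrightarrow> (\<exists>T. kings_trap n T v)"

text \<open>Only meaningful when \<open>can_be_trapped n v\<close> holds; otherwise the value is unspecified.\<close>

definition min_trapping_kings :: "nat \<Rightarrow> cell \<Rightarrow> nat" where
  "min_trapping_kings n v = (LEAST k. \<exists>T. kings_trap n T v \<and> card T = k)"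

end

theory Submission imports Defs begin

text \<open>
  Everything is governed by the four orthogonal directions. A soldier that attacks the cell one
  step from \<open>v\<close> in direction \<open>d\<close>, without standing on \<open>v\<close> or attacking it, must stand in the
  row or column two steps from \<open>v\<close> in direction \<open>d\<close>, at most one cell off the axis
  (\<open>guard_position\<close>). This has two consequences.

  First, if the board extends one step but not two steps from \<open>v\<close> in some direction, the
  orthogonal neighbour on that side cannot be guarded, so \<open>v\<close> cannot be trapped. This is
  precisely the situation of part (i). Second, one soldier guards at most one orthogonal
  neighbour, so at least as many soldiers are needed as \<open>v\<close> has orthogonal neighbours on the
  board (\<open>card_open_dirs_le\<close>).

  Conversely, if the board extends two steps whenever it extends one, the soldiers placed exactly
  two steps away in these directions trap \<open>v\<close>: each covers the three neighbours on its own side,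
  and no two of them are adjacent (\<open>axial_trap\<close>). Hence the minimum is the number of
  orthogonal neighbours of \<open>v\<close>, which is 2 at a corner, 3 on the rest of the border, and 4 inside.
  The one exception is the board with a single cell, a corner without neighbours, where the empty
  set traps.
\<close>

definition dirs :: "(int \<times> int) set" where
  "dirs = {(1, 0), (-1, 0), (0, 1), (0, -1)}"

definition ahead :: "int \<Rightarrow> cell \<Rightarrow> int \<times> int \<Rightarrow> cell" where
  "ahead k v d = (fst v + k * fst d, snd v + k * snd d)"

definition open_dirs :: "nat \<Rightarrow> cell \<Rightarrow> (int \<times> int) set" where
  "open_dirs n v = {d \<in> dirs. ahead 1 v d \<in> board n}"

text \<open>
  The inner product with \<open>d\<close> measures how far \<open>p\<close> lies from \<open>v\<close> in direction \<open>d\<close>. Being next to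
  the neighbour in direction \<open>d\<close> bounds this by 2 and the lateral deviation by 1, so any smaller
  value would put \<open>p\<close> within reach of \<open>v\<close>.
\<close>

lemma guard_position:
  assumes "d \<in> dirs" "king_attacks p (ahead 1 v d)" "p \<noteq> v" "\<not> king_attacks p v"
  shows "(fst p - fst v) * fst d + (snd p - snd v) * snd d = 2"
    and "\<bar>(fst p - fst v) * snd d\<bar> + \<bar>(snd p - snd v) * fst d\<bar> \<le> 1"
proof -
  define x y where xy: "x = fst p - fst v" "y = snd p - snd v"
  have near: "\<bar>x - fst d\<bar> \<le> 1" "\<bar>y - snd d\<bar> \<le> 1"
    using assms(2) by (simp_all add: xy king_attacks_def ahead_def algebra_simps)
  have "\<not> (\<bar>x\<bar> \<le> 1 \<and> \<bar>y\<bar> \<le> 1)"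
    using assms(3,4) by (simp add: xy king_attacks_def)
  then have "x * fst d + y * snd d = 2 \<and> \<bar>x * snd d\<bar> + \<bar>y * fst d\<bar> \<le> 1"
    using assms(1) near unfolding dirs_def
    by (elim insertE emptyE; simp; linarith)
  then show "(fst p - fst v) * fst d + (snd p - snd v) * snd d = 2"
    and "\<bar>(fst p - fst v) * snd d\<bar> + \<bar>(snd p - snd v) * fst d\<bar> \<le> 1"
    by (simp_all add: xy)
qed

lemma guard_unique:
  assumes "d \<in> dirs" "e \<in> dirs" "p \<noteq> v" "\<not> king_attacks p v"
    "king_attacks p (ahead 1 v d)" "king_attacks p (ahead 1 v e)"
  shows "d = e"
proof -
  have "d = e"
    if "x * fst d + y * snd d = 2" "\<bar>x * snd d\<bar> + \<bar>y * fst d\<bar> \<le> 1"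
      "x * fst e + y * snd e = 2" "\<bar>x * snd e\<bar> + \<bar>y * fst e\<bar> \<le> 1" for x y :: int
    using assms(1,2) that by (auto simp: dirs_def)
  from this[OF guard_position[OF assms(1,5,3,4)] guard_position[OF assms(2,6,3,4)]]
  show ?thesis .
qed

lemma guard_exists:
  assumes "kings_trap n T v" "d \<in> open_dirs n v"
  obtains p where "p \<in> T" "p \<in> board n" "p \<noteq> v" "\<not> king_attacks p v"
    "king_attacks p (ahead 1 v d)"
proof -
  have "king_attacks v (ahead 1 v d)"
    using assms(2) by (auto simp: open_dirs_def dirs_def king_attacks_def ahead_def prod_eq_iff)
  then obtain p where "p \<in> T" "king_attacks p (ahead 1 v d)"
    using assms unfolding kings_trap_def open_dirs_def by blast
  moreover have "p \<noteq> v" "p \<in> board n"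
    using assms(1) \<open>p \<in> T\<close> unfolding kings_trap_def by blast+
  moreover from this have "\<not> king_attacks p v"
    using assms(1) \<open>p \<in> T\<close> unfolding kings_trap_def by blast
  ultimately show thesis by (intro that)
qed

text \<open>
  The guard need not stand on the axis, but its coordinate along \<open>d\<close> is on the board, and the
  coordinate across \<open>d\<close> can be taken from \<open>v\<close>.
\<close>

lemma trapped_imp_two_steps:
  assumes "kings_trap n T v" "v \<in> board n" "d \<in> open_dirs n v"
  shows "ahead 2 v d \<in> board n"
proof -
  obtain p where p: "p \<in> board n" "p \<noteq> v" "\<not> king_attacks p v" "king_attacks p (ahead 1 v d)"
    using guard_exists[OF assms(1,3)] by blast
  have d: "d \<in> dirs" using assms(3) by (simp add: open_dirs_def)
  show ?thesis
    using guard_position(1)[OF d p(4,2,3)] d p(1) assms(2)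
    by (auto simp: dirs_def board_def ahead_def)
qed

lemma card_open_dirs_le:
  assumes "kings_trap n T v"
  shows "card (open_dirs n v) \<le> card T"
proof -
  have "\<forall>d \<in> open_dirs n v. \<exists>p. p \<in> T \<and> p \<noteq> v \<and> \<not> king_attacks p v
      \<and> king_attacks p (ahead 1 v d)"
    using guard_exists[OF assms] by metis
  then obtain g where g: "\<And>d. d \<in> open_dirs n v \<Longrightarrow> g d \<in> T \<and> g d \<noteq> v
      \<and> \<not> king_attacks (g d) v \<and> king_attacks (g d) (ahead 1 v d)"
    by metis
  have "inj_on g (open_dirs n v)"
  proof (rule inj_onI)
    fix d e assume de: "d \<in> open_dirs n v" "e \<in> open_dirs n v" "g d = g e"
    then show "d = e"
      using guard_unique[of d e "g d" v] g[of d] g[of e] by (simp add: open_dirs_def)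
  qed
  moreover have "g ` open_dirs n v \<subseteq> T" using g by blast
  moreover have "T \<subseteq> board n" using assms by (simp add: kings_trap_def)
  then have "finite T" by (rule finite_subset) (simp add: board_def)
  ultimately show ?thesis by (intro card_inj_on_le)
qed

text \<open>
  A diagonal neighbour of \<open>v\<close> on the board has its two orthogonal projections on the board as
  well, since the board is a rectangle; so every neighbour lies on an open side.
\<close>

lemma axial_trap:
  assumes v: "v \<in> board n" and two: "\<And>d. d \<in> open_dirs n v \<Longrightarrow> ahead 2 v d \<in> board n"
  shows "kings_trap n (ahead 2 v ` open_dirs n v) v"
  unfolding kings_trap_def
proof (intro conjI ballI impI)
  show "ahead 2 v ` open_dirs n v \<subseteq> board n" using two by blast
  show "v \<notin> ahead 2 v ` open_dirs n v"
    by (auto simp: open_dirs_def dirs_def ahead_def prod_eq_iff)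
next
  fix p q
  assume pq: "p \<in> ahead 2 v ` open_dirs n v \<union> {v}"
    "q \<in> ahead 2 v ` open_dirs n v \<union> {v}" "p \<noteq> q"
  have "v = ahead 2 v (0, 0)" by (simp add: ahead_def)
  then obtain d e where de: "p = ahead 2 v d" "q = ahead 2 v e" using pq by blast
  \<comment> \<open>All coordinate differences are even, so cells within distance 1 of each other coincide.\<close>
  show "\<not> king_attacks p q"
  proof
    assume "king_attacks p q"
    then have "fst d = fst e" "snd d = snd e"
      unfolding de king_attacks_def ahead_def by (simp_all, linarith+)
    with pq(3) show False unfolding de ahead_def by simp
  qed
next
  fix w assume w: "w \<in> board n" "king_attacks v w"
  have "\<exists>d \<in> open_dirs n v. (fst w - fst v) * fst d + (snd w - snd v) * snd d = 1"
  proof (cases "fst w = fst v")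
    case True
    then have "snd w - snd v = 1 \<or> snd w - snd v = -1"
      using w(2) by (auto simp: king_attacks_def prod_eq_iff)
    then have "(0, snd w - snd v) \<in> open_dirs n v" "(snd w - snd v) * (snd w - snd v) = 1"
      using w v by (auto simp: open_dirs_def dirs_def board_def ahead_def)
    then show ?thesis by force
  next
    case False
    then have "fst w - fst v = 1 \<or> fst w - fst v = -1"
      using w(2) by (auto simp: king_attacks_def)
    then have "(fst w - fst v, 0) \<in> open_dirs n v" "(fst w - fst v) * (fst w - fst v) = 1"
      using w v by (auto simp: open_dirs_def dirs_def board_def ahead_def)
    then show ?thesis by force
  qed
  then obtain d where d: "d \<in> open_dirs n v"
    "(fst w - fst v) * fst d + (snd w - snd v) * snd d = 1" by blast
  define x y where xy: "x = fst w - fst v" "y = snd w - snd v"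
  have "\<bar>x\<bar> \<le> 1" "\<bar>y\<bar> \<le> 1" using w(2) by (auto simp: xy king_attacks_def)
  moreover have "d \<in> dirs" using d(1) by (simp add: open_dirs_def)
  ultimately have "(x \<noteq> 2 * fst d \<or> y \<noteq> 2 * snd d) \<and> \<bar>x - 2 * fst d\<bar> \<le> 1 \<and> \<bar>y - 2 * snd d\<bar> \<le> 1"
    using d(2) unfolding dirs_def xy[symmetric]
    by (elim insertE emptyE; simp)
  then have "king_attacks (ahead 2 v d) w"
    by (auto simp: king_attacks_def ahead_def xy algebra_simps)
  then show "\<exists>p \<in> ahead 2 v ` open_dirs n v. king_attacks p w" using d(1) by blast
qed

lemma can_be_trapped_iff:
  assumes "v \<in> board n"
  shows "can_be_trapped n v \<longleftrightarrow> (\<forall>d \<in> open_dirs n v. ahead 2 v d \<in> board n)"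
  using assms trapped_imp_two_steps axial_trap unfolding can_be_trapped_def by blast

lemma min_trapping_kings_eq:
  assumes "v \<in> board n" "can_be_trapped n v"
  shows "min_trapping_kings n v = card (open_dirs n v)"
  unfolding min_trapping_kings_def
proof (rule Least_equality)
  have "kings_trap n (ahead 2 v ` open_dirs n v) v"
    using assms can_be_trapped_iff axial_trap by blast
  moreover have "inj_on (ahead 2 v) (open_dirs n v)"
    by (auto simp: inj_on_def ahead_def prod_eq_iff)
  ultimately show "\<exists>T. kings_trap n T v \<and> card T = card (open_dirs n v)"
    using card_image by blast
next
  fix k assume "\<exists>T. kings_trap n T v \<and> card T = k"
  then show "card (open_dirs n v) \<le> k" using card_open_dirs_le by blast
qed

lemma two_steps_iff:
  assumes "(a, b) \<in> board n"
  shows "(\<forall>d \<in> open_dirs n (a, b). ahead 2 (a, b) d \<in> board n)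
    \<longleftrightarrow> \<not> (a \<in> {2, int n - 1} \<or> b \<in> {2, int n - 1})"
proof -
  have "1 \<le> a" "a \<le> int n" "1 \<le> b" "b \<le> int n"
    using assms by (simp_all add: board_def)
  moreover have guarded: "(\<forall>d \<in> open_dirs n (a, b). P d) \<longleftrightarrow>
      (\<forall>d \<in> dirs. ahead 1 (a, b) d \<in> board n \<longrightarrow> P d)" for P
    by (auto simp: open_dirs_def)
  ultimately have "(\<forall>d \<in> open_dirs n (a, b). ahead 2 (a, b) d \<in> board n) \<longleftrightarrow>
      (a + 1 \<le> int n \<longrightarrow> a + 2 \<le> int n) \<and> (1 \<le> a - 1 \<longrightarrow> 1 \<le> a - 2) \<and>
      (b + 1 \<le> int n \<longrightarrow> b + 2 \<le> int n) \<and> (1 \<le> b - 1 \<longrightarrow> 1 \<le> b - 2)"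
    by (simp add: guarded dirs_def ahead_def board_def)
  moreover have "(a + 1 \<le> int n \<longrightarrow> a + 2 \<le> int n) \<longleftrightarrow> a \<noteq> int n - 1"
      "(1 \<le> a - 1 \<longrightarrow> 1 \<le> a - 2) \<longleftrightarrow> a \<noteq> 2"
      "(b + 1 \<le> int n \<longrightarrow> b + 2 \<le> int n) \<longleftrightarrow> b \<noteq> int n - 1"
      "(1 \<le> b - 1 \<longrightarrow> 1 \<le> b - 2) \<longleftrightarrow> b \<noteq> 2"
    by linarith+
  ultimately show ?thesis by blast
qed

lemma card_open_dirs:
  assumes "(a, b) \<in> board n"
  shows "card (open_dirs n (a, b))
    = of_bool (a \<noteq> int n) + of_bool (a \<noteq> 1) + of_bool (b \<noteq> int n) + of_bool (b \<noteq> 1)"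
proof -
  have "open_dirs n (a, b) =
      (if a \<noteq> int n then {(1, 0)} else {}) \<union> (if a \<noteq> 1 then {(-1, 0)} else {})
      \<union> (if b \<noteq> int n then {(0, 1)} else {}) \<union> (if b \<noteq> 1 then {(0, -1)} else {})"
    using assms by (auto simp: open_dirs_def dirs_def ahead_def board_def)
  then show ?thesis by simp
qed

theorem mainTheorem10:
  fixes n :: nat and a b :: int
  assumes "(a, b) \<in> board n"
  shows "(a \<in> {2, int n - 1} \<or> b \<in> {2, int n - 1} \<longrightarrow> \<not> can_be_trapped n (a, b)) \<and>
    (\<not> (a \<in> {2, int n - 1} \<or> b \<in> {2, int n - 1}) \<longrightarrow>
      can_be_trapped n (a, b) \<and>
      (corner_cell n (a, b) \<and> n \<noteq> 1 \<longrightarrow> min_trapping_kings n (a, b) = 2) \<and>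
      (border_cell n (a, b) \<and> \<not> corner_cell n (a, b) \<longrightarrow> min_trapping_kings n (a, b) = 3) \<and>
      (\<not> border_cell n (a, b) \<longrightarrow> min_trapping_kings n (a, b) = 4))"
proof -
  have trap: "can_be_trapped n (a, b) \<longleftrightarrow> \<not> (a \<in> {2, int n - 1} \<or> b \<in> {2, int n - 1})"
    using can_be_trapped_iff[OF assms] two_steps_iff[OF assms] by simp
  have "(corner_cell n (a, b) \<and> n \<noteq> 1 \<longrightarrow> card (open_dirs n (a, b)) = 2) \<and>
      (border_cell n (a, b) \<and> \<not> corner_cell n (a, b) \<longrightarrow> card (open_dirs n (a, b)) = 3) \<and>
      (\<not> border_cell n (a, b) \<longrightarrow> card (open_dirs n (a, b)) = 4)"
    if "\<not> (a \<in> {2, int n - 1} \<or> b \<in> {2, int n - 1})"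
    using that assms card_open_dirs[OF assms]
    by (auto simp: corner_cell_def border_cell_def board_def)
  then show ?thesis using trap min_trapping_kings_eq[OF assms] by simp
qed

end
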